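(* For every positive integer $\lambda$, there are only finitely many nontrivial graphical $t$-$\bigl(\binom{n}{2}, k, \lambda\bigr)$ designs with $t \geq 2$ (here $n$, $t$, $k$ range over all positive integers with $t\ge 2$, and designs may have repeated blocks).
   Context: For positive integers $t,\lambda$, an integer $k \ge t$ and a set $X$ of cardinality $v$, a $t$-$(v,k,\lambda)$ design is a pair $(X,\mathcal{B})$, where $\mathcal{B}$ is a finite multiset of $k$-subsets of $X$ such that every $t$-subset of $X$ is contained in exactly $\lambda$ members of $\mathcal{B}$, counted with multiplicity. The multiplicity of a $k$-subset $B$ in $\mathcal{B}$ is denoted $\mu_{\mathcal{B}}(B)$. The design is empty if $\mu_{\mathcal{B}}(B)=0$ for every $k$-subset $B$ of $X$; it contains the complete design if $\mu_{\mathcal{B}}(B)\ge 1$ for every $k$-subset $B$ of $X$. It is nontrivial if $t<k<v$ and it neither is empty nor contains the complete design. For each $n$, fix an $n$-element set $V$; $K_n$ is the complete graph with vertex set $V$, and $X=E(K_n)=\binom{V}{2}$ is the set of all $2$-subsets of $V$. The symmetric group $\mathrm{Sym}(V)$ acts on $X$ by $\sigma(\{x,y\})=\{\sigma(x),\sigma(y)\}$ and on subsets of $X$ elementwise. A $t$-$\bigl(\binom n2,k,\lambda\bigr)$ design on $X=E(K_n)$ is graphical if $\mu_{\mathcal{B}}(\sigma(B))=\mu_{\mathcal{B}}(B)$ for all $\sigma\in\mathrm{Sym}(V)$ and all $k$-subsets $B$ of $X$. *)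

theory Defs
  imports "HOL-Library.Ramsey" "HOL-Library.Multiset" "HOL-Combinatorics.Permutations"
begin

text \<open>
  Throughout, \<open>nsets X k\<close> is the set of \<open>k\<close>-subsets of \<open>X\<close>, and the multiplicity of a
  block \<open>B\<close> in the multiset \<open>\<B>\<close> of blocks is \<open>count \<B> B\<close>.
\<close>

definition t_design :: "'a set \<Rightarrow> nat \<Rightarrow> nat \<Rightarrow> nat \<Rightarrow> nat \<Rightarrow> 'a set multiset \<Rightarrow> bool" where
  "t_design X t v k l \<B> \<longleftrightarrow>
     finite X \<and> card X = v \<and> 0 < t \<and> 0 < l \<and> t \<le> k \<and>
     set_mset \<B> \<subseteq> nsets X k \<and>
     (\<forall>T \<in> nsets X t. size {# B \<in># \<B>. T \<subseteq> B #} = l)"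

definition empty_design :: "'a set \<Rightarrow> nat \<Rightarrow> 'a set multiset \<Rightarrow> bool" where
  "empty_design X k \<B> \<longleftrightarrow> (\<forall>B \<in> nsets X k. count \<B> B = 0)"

definition contains_complete_design :: "'a set \<Rightarrow> nat \<Rightarrow> 'a set multiset \<Rightarrow> bool" where
  "contains_complete_design X k \<B> \<longleftrightarrow> (\<forall>B \<in> nsets X k. 1 \<le> count \<B> B)"

definition nontrivial_design :: "'a set \<Rightarrow> nat \<Rightarrow> nat \<Rightarrow> 'a set multiset \<Rightarrow> bool" where
  "nontrivial_design X t k \<B> \<longleftrightarrow>
     t < k \<and> k < card X \<and> \<not> empty_design X k \<B> \<and> \<not> contains_complete_design X k \<B>"

definition complete_graph_edges :: "'a set \<Rightarrow> 'a set set" where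
  "complete_graph_edges V = nsets V 2"

text \<open>
  The points of a graphical design are edges \<open>{x, y}\<close>, so its blocks are sets of edges;
  \<open>\<sigma>\<close> acts on edges by \<open>image \<sigma>\<close> and on blocks by \<open>image (image \<sigma>)\<close>.
\<close>

definition graphical :: "'a set \<Rightarrow> nat \<Rightarrow> 'a set set multiset \<Rightarrow> bool" where
  "graphical V k \<B> \<longleftrightarrow>
     (\<forall>\<sigma>. \<sigma> permutes V \<longrightarrow>
        (\<forall>B \<in> nsets (complete_graph_edges V) k. count \<B> ((`) ((`) \<sigma>) B) = count \<B> B))"

text \<open>
  The fixed vertex set of the complete graph on \<open>n\<close> vertices is taken to be \<open>{..<n}\<close>.
\<close>

definition nontrivial_graphical_design ::
    "nat \<Rightarrow> nat \<Rightarrow> nat \<Rightarrow> nat \<Rightarrow> nat set set multiset \<Rightarrow> bool" where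
  "nontrivial_graphical_design n t k l \<B> \<longleftrightarrow>
     t_design (complete_graph_edges {..<n}) t (n choose 2) k l \<B> \<and>
     nontrivial_design (complete_graph_edges {..<n}) t k \<B> \<and>
     graphical {..<n} k \<B>"

end

theory Submission
  imports Defs
begin

text \<open>
  If a block \<open>B\<close> contains a set \<open>T\<close> of \<open>t\<close> edges, then the transpositions of vertices not met by
  \<open>T\<close> send \<open>B\<close> to blocks that still contain \<open>T\<close>, and there are at most \<open>l\<close> of those. Hence as soon
  as more than \<open>2l\<close> vertices are not met by \<open>T\<close>, they are pairwise twins in \<open>B\<close>.
  Nontriviality forces \<open>t + k < n choose 2\<close>: otherwise, by inclusion-exclusion, the number of blocks
  avoiding a set of size \<open>(n choose 2) - k\<close> is constant, that is, all multiplicities agree.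
  So for large \<open>n\<close> one can choose \<open>T\<close> missing a set \<open>U\<close> of about \<open>n / 4\<close> vertices and having two isolated
  edges. Let \<open>B\<close> be a block containing \<open>T\<close>. Replacing an isolated edge of \<open>T\<close> by an edge of \<open>B - T\<close> frees
  some of its end points, which become twins of the vertices in \<open>U\<close>; this makes \<open>U\<close> a clique in \<open>B\<close>.
  Then \<open>k - t\<close> is quadratic in \<open>n\<close>, so any \<open>O(l)\<close> vertices can be missed by some \<open>t\<close> edges of \<open>B\<close>.
  Thus all vertices are twins in \<open>B\<close>, and \<open>B\<close> is the complete graph, contradicting \<open>k < n choose 2\<close>.
\<close>

section \<open>Block counts in designs\<close>

lemma size_filter_mset_extend:
  assumes "finite X" "set_mset M \<subseteq> nsets X k" "I \<subseteq> X"
  shows "(\<Sum>x\<in>X - I. size {#B \<in># M. insert x I \<subseteq> B#}) = (k - card I) * size {#B \<in># M. I \<subseteq> B#}"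
  using assms(2)
proof (induction M)
  case empty
  then show ?case by simp
next
  case (add B M)
  have B: "B \<subseteq> X" "card B = k" "finite B"
    using add.prems by (auto simp: nsets_def)
  \<comment> \<open>Pairs of a block containing \<open>I\<close> and a further point of it are
    counted twice, one block at a time: \<open>B\<close> contributes its \<open>k - card I\<close>
    points outside \<open>I\<close>, or nothing if it does not contain \<open>I\<close>.\<close>
  have "(\<Sum>x\<in>X - I. size {#C \<in># add_mset B M. insert x I \<subseteq> C#})
      = (\<Sum>x\<in>X - I. of_bool (insert x I \<subseteq> B)) + (\<Sum>x\<in>X - I. size {#C \<in># M. insert x I \<subseteq> C#})"
    by (subst sum.distrib [symmetric], rule sum.cong) auto
  also have "(\<Sum>x\<in>X - I. of_bool (insert x I \<subseteq> B)) = of_bool (I \<subseteq> B) * (k - card I)"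
  proof (cases "I \<subseteq> B")
    case True
    then have "(X - I) \<inter> {x. insert x I \<subseteq> B} = B - I"
      using B by auto
    then show ?thesis
      using True B assms(1) finite_subset[OF True B(3)] by (simp add: card_Diff_subset)
  qed auto
  finally show ?case
    using add by auto
qed

text \<open>A t-design is also an i-design for each i below t. Going down from \<open>t\<close>, the
  previous double count writes \<open>k - card I\<close> times the wanted number as a sum over the
  one-point extensions of \<open>I\<close>, whose counts all agree by induction; the factor is
  positive and cancels.\<close>

lemma design_extension_count:
  assumes "t_design X t v k l \<B>" "I \<subseteq> X" "I' \<subseteq> X" "card I = card I'" "card I \<le> t" "t < k"
  shows "size {#B \<in># \<B>. I \<subseteq> B#} = size {#B \<in># \<B>. I' \<subseteq> B#}"
  using assms(2-5)
proof (induction "t - card I" arbitrary: I I')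
  case 0
  have "finite X"
    using assms(1) by (simp add: t_design_def)
  with 0 have "I \<in> nsets X t" "I' \<in> nsets X t"
    by (auto simp: nsets_def intro: finite_subset)
  then show ?case
    using assms(1) by (simp add: t_design_def)
next
  case (Suc d)
  have X: "finite X" "set_mset \<B> \<subseteq> nsets X k"
    using assms(1) by (auto simp: t_design_def)
  have fin: "finite I" "finite I'"
    using Suc.prems X finite_subset by blast+
  define c where "c = card (X - I)"
  have c': "card (X - I') = c"
    using Suc.prems fin by (simp add: c_def card_Diff_subset)
  have *: "size {#B \<in># \<B>. insert x I \<subseteq> B#} = size {#B \<in># \<B>. insert x' I' \<subseteq> B#}"
    if "x \<in> X - I" "x' \<in> X - I'" for x x'
    using Suc.hyps(2) Suc.prems fin that by (intro Suc.hyps(1)) auto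
  have "(\<Sum>x\<in>X - I. size {#B \<in># \<B>. insert x I \<subseteq> B#}) = (\<Sum>x\<in>X - I'. size {#B \<in># \<B>. insert x I' \<subseteq> B#})"
  proof (cases "X - I = {}")
    case True
    then have "card (X - I') = 0"
      using c' c_def by (metis card.empty)
    then have "X - I' = {}"
      using X by simp
    with True show ?thesis by (simp only: sum.empty)
  next
    case False
    then obtain x where x: "x \<in> X - I" by blast
    then have "X - I' \<noteq> {}" using c' X c_def by force
    then obtain x' where x': "x' \<in> X - I'" by blast
    have "\<And>y. y \<in> X - I' \<Longrightarrow> size {#B \<in># \<B>. insert y I' \<subseteq> B#} = size {#B \<in># \<B>. insert x I \<subseteq> B#}"
      using * x by simp
    moreover have "\<And>y. y \<in> X - I \<Longrightarrow> size {#B \<in># \<B>. insert y I \<subseteq> B#} = size {#B \<in># \<B>. insert x I \<subseteq> B#}"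
      using * x x' by metis
    ultimately show ?thesis
      using c' c_def by simp
  qed
  then have "(k - card I) * size {#B \<in># \<B>. I \<subseteq> B#} = (k - card I) * size {#B \<in># \<B>. I' \<subseteq> B#}"
    using size_filter_mset_extend[OF X] Suc.prems by metis
  then show ?case
    using Suc.prems assms(6) by simp
qed

text \<open>Inclusion-exclusion as an induction on \<open>card J\<close>: among the blocks that
  contain \<open>I\<close> and avoid \<open>J - {x}\<close>, those avoiding \<open>J\<close> are
  what remains after discarding those that contain \<open>x\<close>. Moving \<open>x\<close> from
  \<open>J\<close> to \<open>I\<close> preserves \<open>card I + card J\<close>, so both counts fall
  under the induction hypothesis.\<close>

lemma design_separation_count:
  assumes D: "t_design X t v k l \<B>" "t < k"
    and "I \<subseteq> X" "I' \<subseteq> X" "J \<subseteq> X" "J' \<subseteq> X" "I \<inter> J = {}" "I' \<inter> J' = {}"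
    and "card I = card I'" "card J = card J'" "card I + card J \<le> t"
  shows "size {#B \<in># \<B>. I \<subseteq> B \<and> B \<inter> J = {}#} = size {#B \<in># \<B>. I' \<subseteq> B \<and> B \<inter> J' = {}#}"
  using assms(3-)
proof (induction "card J" arbitrary: I I' J J')
  case 0
  have "finite J" "finite J'"
    using D 0 finite_subset unfolding t_design_def by blast+
  with 0 have "J = {}" "J' = {}" by auto
  with 0 show ?case
    using design_extension_count[OF D(1), of I I'] D(2) by simp
next
  case (Suc j)
  have fin: "finite X" "finite I" "finite I'" "finite J" "finite J'"
    using D Suc.prems finite_subset unfolding t_design_def by blast+
  obtain x K where J: "J = insert x K" "x \<notin> K" "card K = j"
    using Suc.hyps(2) by (metis card_Suc_eq)
  obtain x' K' where J': "J' = insert x' K'" "x' \<notin> K'" "card K' = j"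
    using Suc.hyps(2) Suc.prems(8) by (metis card_Suc_eq)
  have split: "size {#B \<in># M. I \<subseteq> B \<and> B \<inter> K = {}#} =
      size {#B \<in># M. insert x I \<subseteq> B \<and> B \<inter> K = {}#} + size {#B \<in># M. I \<subseteq> B \<and> B \<inter> insert x K = {}#}"
    for I K :: "'a set" and x and M :: "'a set multiset"
    by (induction M) auto
  have 1: "size {#B \<in># \<B>. I \<subseteq> B \<and> B \<inter> K = {}#} = size {#B \<in># \<B>. I' \<subseteq> B \<and> B \<inter> K' = {}#}"
    using Suc.prems J J' fin by (intro Suc.hyps(1)) auto
  have 2: "size {#B \<in># \<B>. insert x I \<subseteq> B \<and> B \<inter> K = {}#} = size {#B \<in># \<B>. insert x' I' \<subseteq> B \<and> B \<inter> K' = {}#}"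
    using Suc.prems J J' fin by (intro Suc.hyps(1)) auto
  show ?case
    using 1 2 split[of I K \<B> x] split[of I' K' \<B> x'] J J' by simp
qed

lemma nontrivial_design_bound:
  assumes D: "t_design X t v k l \<B>" and N: "nontrivial_design X t k \<B>"
  shows "t + k < v"
proof (rule ccontr)
  assume "\<not> t + k < v"
  have X: "finite X" "card X = v" "t < k" "k < v" "set_mset \<B> \<subseteq> nsets X k"
    using D N by (auto simp: t_design_def nontrivial_design_def)
  \<comment> \<open>A block avoiding \<open>X - B\<close> lies inside \<open>B\<close> and has the
    same size, so it is \<open>B\<close>. Multiplicities thus become counts of blocks avoiding
    \<open>v - k\<close> points, and \<open>v - k \<le> t\<close> puts them within reach of
    \<open>design_separation_count\<close>.\<close>
  have count: "count \<B> B = size {#C \<in># \<B>. {} \<subseteq> C \<and> C \<inter> (X - B) = {}#}" if "B \<in> nsets X k" for B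
  proof -
    have "{#C \<in># \<B>. {} \<subseteq> C \<and> C \<inter> (X - B) = {}#} = {#C \<in># \<B>. C = B#}"
    proof (rule filter_mset_cong)
      fix C assume "C \<in># \<B>"
      then have C: "C \<in> nsets X k" using X by auto
      show "({} \<subseteq> C \<and> C \<inter> (X - B) = {}) = (C = B)"
      proof
        assume "{} \<subseteq> C \<and> C \<inter> (X - B) = {}"
        then have "C \<subseteq> B" using C by (auto simp: nsets_def)
        then show "C = B" using C that by (auto simp: nsets_def card_subset_eq)
      qed auto
    qed simp
    then show ?thesis by (simp add: filter_eq_replicate_mset)
  qed
  have const: "count \<B> B = count \<B> C" if "B \<in> nsets X k" "C \<in> nsets X k" for B C
    unfolding count[OF that(1)] count[OF that(2)]
    using that X \<open>\<not> t + k < v\<close>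
    by (intro design_separation_count[OF D]) (auto simp: nsets_def card_Diff_subset)
  obtain B C where "B \<in> nsets X k" "count \<B> B \<noteq> 0" "C \<in> nsets X k" "\<not> 1 \<le> count \<B> C"
    using N unfolding nontrivial_design_def empty_design_def contains_complete_design_def by blast
  with const[of B C] show False by simp
qed

lemma design_block_exists:
  assumes "t_design X t v k l \<B>" "T \<subseteq> X" "card T = t"
  obtains B where "B \<in># \<B>" "T \<subseteq> B"
proof -
  have "T \<in> nsets X t"
    using assms by (auto simp: nsets_def t_design_def dest: finite_subset)
  then have "size {#B \<in># \<B>. T \<subseteq> B#} \<noteq> 0"
    using assms(1) by (auto simp: t_design_def)
  then have "{#B \<in># \<B>. T \<subseteq> B#} \<noteq> {#}" by auto
  then show thesis
    by (auto elim!: multiset_nonemptyE intro: that)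
qed

lemma design_card_blocks_containing:
  assumes "t_design X t v k l \<B>" "T \<subseteq> X" "card T = t"
  shows "card {B \<in> set_mset \<B>. T \<subseteq> B} \<le> l"
proof -
  have "T \<in> nsets X t"
    using assms by (auto simp: nsets_def t_design_def dest: finite_subset)
  then have "size {#B \<in># \<B>. T \<subseteq> B#} = l"
    using assms(1) by (auto simp: t_design_def)
  moreover have "card (set_mset M) \<le> size M" for M :: "'a set multiset"
    by (induction M) (auto intro: le_trans[OF card_insert_le_m1] simp: card_insert_if)
  ultimately show ?thesis
    by (metis set_mset_filter)
qed

text \<open>All copies of a block are among the \<open>l\<close> blocks through any \<open>t\<close>
  of its points. This leaves finitely many designs on a given point set.\<close>

lemma design_count_le:
  assumes "t_design X t v k l \<B>"
  shows "count \<B> B \<le> l"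
proof (cases "B \<in># \<B>")
  case True
  then have B: "B \<in> nsets X k"
    using assms by (auto simp: t_design_def)
  then obtain T where T: "T \<subseteq> B" "card T = t"
    using assms obtain_subset_with_card_n[of t B] by (auto simp: t_design_def nsets_def)
  with B have "T \<in> nsets X t"
    by (auto simp: nsets_def intro: finite_subset)
  then have "size {#C \<in># \<B>. T \<subseteq> C#} = l"
    using assms by (auto simp: t_design_def)
  moreover have "count \<B> B = count {#C \<in># \<B>. T \<subseteq> C#} B"
    using T by simp
  ultimately show ?thesis
    by (metis count_le_size)
next
  case False
  then show ?thesis by (simp add: not_in_iff)
qed

section \<open>Twin vertices in a block\<close>

definition twins :: "'a set set \<Rightarrow> 'a \<Rightarrow> 'a \<Rightarrow> bool" where
  "twins B a b \<longleftrightarrow> (\<forall>z. z \<noteq> a \<longrightarrow> z \<noteq> b \<longrightarrow> {a, z} \<in> B \<longleftrightarrow> {b, z} \<in> B)"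

lemma twins_sym: "twins B a b \<Longrightarrow> twins B b a"
  by (auto simp: twins_def)

text \<open>For a graph \<open>B\<close>, being twins means that swapping the two vertices preserves
  \<open>B\<close>; the edge joining them is left free. Only \<open>z = b\<close> needs care: there
  the comparison passes through the edge \<open>{a, c}\<close>.\<close>

lemma twins_trans:
  assumes "twins B a b" "twins B b c"
  shows "twins B a c"
proof -
  have "{a, z} \<in> B \<longleftrightarrow> {c, z} \<in> B" if "z \<noteq> a" "z \<noteq> c" for z
  proof (cases "z = b")
    case True
    show ?thesis
    proof (cases "a = c")
      case False
      have "{a, c} \<in> B \<longleftrightarrow> {b, c} \<in> B"
        using assms(1) False True that by (simp add: twins_def)
      moreover have "{b, a} \<in> B \<longleftrightarrow> {c, a} \<in> B"
        using assms(2) False True that by (simp add: twins_def)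
      ultimately show ?thesis using True by (simp add: insert_commute)
    qed simp
  next
    case False
    then show ?thesis
      using assms that unfolding twins_def by blast
  qed
  then show ?thesis by (simp add: twins_def)
qed

text \<open>An edge inside \<open>U\<close> can be moved one end at a time, since the new end is a
  twin of the old one. Pairwise twins therefore form a clique or an independent set.\<close>

lemma twins_homogeneous:
  assumes tw: "\<And>a b. a \<in> U \<Longrightarrow> b \<in> U \<Longrightarrow> twins B a b"
    and "{x, y} \<in> B" "x \<in> U" "y \<in> U" "x \<noteq> y" "a \<in> U" "b \<in> U" "a \<noteq> b"
  shows "{a, b} \<in> B"
proof -
  have step: "{p, r} \<in> B" if "{p, q} \<in> B" "p \<noteq> q" "p \<noteq> r" "p \<in> U" "q \<in> U" "r \<in> U" for p q r
    using tw[of q r] that unfolding twins_def by (metis insert_commute)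
  show ?thesis
  \<comment> \<open>If \<open>x = b\<close>, moving \<open>y\<close> to \<open>b\<close> would
    collapse the edge, so \<open>y\<close> is moved to \<open>a\<close> at once.\<close>
  proof (cases "x = b")
    case True
    then show ?thesis using step[of x y a] assms by (simp add: insert_commute)
  next
    case False
    then have "{x, b} \<in> B" using step[of x y b] assms by simp
    then have "{b, a} \<in> B" using step[of b x a] assms False by (simp add: insert_commute)
    then show ?thesis by (simp add: insert_commute)
  qed
qed

text \<open>The two swaps differ by a 3-cycle on \<open>u\<close>, \<open>v\<close>,
  \<open>w\<close>, which then preserves \<open>B\<close>. So the three vertices have the same
  neighbours elsewhere, and the three edges among them are all present or all absent.\<close>

lemma twins_of_transpose_images_eq:
  assumes "(`) (transpose u v) ` B = (`) (transpose u w) ` B" "u \<noteq> v" "u \<noteq> w" "v \<noteq> w"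
  shows "twins B u v"
proof -
  have mem: "{transpose u x p, transpose u x q} \<in> B \<longleftrightarrow> {p, q} \<in> (`) (transpose u x) ` B" for x p q
  proof -
    have inj: "inj ((`) (transpose u x))"
      by (rule injI) (metis inj_image_eq_iff inj_transpose)
    have "{p, q} = transpose u x ` {transpose u x p, transpose u x q}"
      by simp
    then show ?thesis using inj by (metis inj_image_mem_iff)
  qed
  have key: "{transpose u v p, transpose u v q} \<in> B \<longleftrightarrow> {transpose u w p, transpose u w q} \<in> B" for p q
    using mem assms(1) by simp
  have "{u, z} \<in> B \<longleftrightarrow> {v, z} \<in> B" if "z \<noteq> u" "z \<noteq> v" for z
  proof (cases "z = w")
    case True
    then show ?thesis
      using key[of u w] assms by (simp add: insert_commute)
  next
    case False
    then show ?thesis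
      using key[of u z] key[of v z] assms that by simp
  qed
  then show ?thesis by (simp add: twins_def)
qed

text \<open>Swapping \<open>u\<close> with its various non-twins in \<open>U\<close> gives distinct
  blocks containing \<open>T\<close>, so \<open>u\<close> has at most \<open>l\<close> non-twins
  there. If \<open>a\<close> and \<open>b\<close> were not twins, transitivity would make every
  vertex of \<open>U\<close> a non-twin of one of them, whence
  \<open>card U \<le> 2 * l\<close>.\<close>

lemma twins_uncovered:
  assumes D: "t_design (complete_graph_edges V) t v k l \<B>" and G: "graphical V k \<B>"
    and B: "B \<in># \<B>" and T: "T \<subseteq> B" "card T = t"
    and U: "U \<subseteq> V" "finite U" "U \<inter> \<Union>T = {}" "2 * l < card U"
    and "a \<in> U" "b \<in> U"
  shows "twins B a b"
proof (rule ccontr)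
  assume ab: "\<not> twins B a b"
  have blocks: "set_mset \<B> \<subseteq> nsets (complete_graph_edges V) k"
    using D by (simp add: t_design_def)
  then have BX: "B \<in> nsets (complete_graph_edges V) k" "B \<subseteq> complete_graph_edges V"
    using B by (auto simp: nsets_def)
  have bound: "card {w \<in> U. \<not> twins B u w} \<le> l" if u: "u \<in> U" for u
  proof -
    let ?f = "\<lambda>w. (`) (transpose u w) ` B"
    have "inj_on ?f {w \<in> U. \<not> twins B u w}"
    proof (rule inj_onI, rule ccontr)
      fix w w' assume *: "w \<in> {w \<in> U. \<not> twins B u w}" "w' \<in> {w \<in> U. \<not> twins B u w}" "?f w = ?f w'" "w \<noteq> w'"
      have "u \<noteq> w" "u \<noteq> w'"
        using * by (auto simp: twins_def)
      then show False
        using twins_of_transpose_images_eq[of u w B w'] * by blast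
    qed
    moreover have "?f ` {w \<in> U. \<not> twins B u w} \<subseteq> {C \<in> set_mset \<B>. T \<subseteq> C}"
    proof (rule image_subsetI)
      fix w assume "w \<in> {w \<in> U. \<not> twins B u w}"
      then have w: "w \<in> U" by simp
      have "transpose u w permutes V"
        using u w U by (intro permutes_swap_id) auto
      then have "count \<B> (?f w) = count \<B> B"
        using G BX by (auto simp: graphical_def)
      then have "?f w \<in># \<B>"
        using B by (metis count_greater_zero_iff)
      moreover have "T \<subseteq> ?f w"
      proof
        fix e assume e: "e \<in> T"
        have "\<And>x. x \<in> e \<Longrightarrow> transpose u w x = x"
          using e U u w by (intro transpose_apply_other) auto
        then have "transpose u w ` e = e" by simp
        then show "e \<in> ?f w"
          using e T by (metis imageI subsetD)
      qed
      ultimately show "?f w \<in> {C \<in> set_mset \<B>. T \<subseteq> C}" by simp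
    qed
    ultimately have "card {w \<in> U. \<not> twins B u w} \<le> card {C \<in> set_mset \<B>. T \<subseteq> C}"
      by (rule card_inj_on_le) simp
    also have "\<dots> \<le> l"
      using design_card_blocks_containing[OF D] T BX by blast
    finally show ?thesis .
  qed
  have "\<not> twins B a w \<or> \<not> twins B b w" for w
    using ab twins_trans[of B a w b] twins_sym[of B b w] by blast
  then have "U \<subseteq> {w \<in> U. \<not> twins B a w} \<union> {w \<in> U. \<not> twins B b w}"
    by blast
  then have "card U \<le> card ({w \<in> U. \<not> twins B a w} \<union> {w \<in> U. \<not> twins B b w})"
    using U by (intro card_mono) auto
  also have "\<dots> \<le> l + l"
    using bound[of a] bound[of b] \<open>a \<in> U\<close> \<open>b \<in> U\<close> by (intro card_Un_le [THEN order_trans] add_mono) auto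
  finally show False using U by simp
qed

section \<open>Finiteness of bounded multisets and numerical estimates\<close>

lemma finite_bounded_multisets:
  assumes "finite A"
  shows "finite {M. set_mset M \<subseteq> A \<and> (\<forall>x. count M x \<le> l)}" (is "finite ?S")
proof (rule finite_imageD)
  have "count ` ?S \<subseteq> {f. \<forall>x. (x \<in> A \<longrightarrow> f x \<in> {..l}) \<and> (x \<notin> A \<longrightarrow> f x = 0)}"
    by (auto simp: count_eq_zero_iff)
  then show "finite (count ` ?S)"
    by (rule finite_subset) (intro finite_set_of_finite_funs assms finite_atMost)
  show "inj_on count ?S"
    by (simp add: inj_on_def count_inject)
qed

text \<open>Since \<open>2 * t < t + k < n choose 2\<close>, this leaves room for \<open>t\<close>
  edges on three quarters of the vertices.\<close>

lemma choose_two_ge_half: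
  assumes "4 \<le> n"
  shows "n choose 2 \<le> 2 * ((n - n div 4) choose 2)"
proof -
  define q where "q = n div 4"
  obtain r where r: "n = 4 * q + r"
    unfolding q_def by (metis mult_div_mod_eq)
  have q: "1 \<le> q" using assms by (simp add: q_def)
  have two: "2 * (m choose 2) = m * (m - 1)" for m :: nat
    by (cases m) (simp_all add: choose_two)
  have "n * (n - 1) \<le> 2 * ((n - q) * (n - q - 1))"
  proof -
    obtain p where p: "q = Suc p" using q by (cases q) auto
    show ?thesis unfolding r p by (simp add: algebra_simps)
  qed
  then have "2 * (n choose 2) \<le> 2 * (2 * ((n - q) choose 2))"
    unfolding two by (simp add: two)
  then show ?thesis by (simp add: q_def)
qed

text \<open>The source of the constant 500, chosen generously: a clique on about a quarter of the
  vertices must have at least as many edges as can meet \<open>2 * l + 3\<close> vertices.\<close>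

lemma mult_le_choose_two:
  assumes "500 * (l + 1) \<le> n"
  shows "(2 * l + 3) * n \<le> (n div 4 - 4) choose 2"
proof -
  define r where "r = n div 4 - 5"
  have r: "120 * (l + 1) \<le> r" "n \<le> 4 * r + 23" "n div 4 - 4 = Suc r"
    using assms by (auto simp: r_def)
  have "2 * ((2 * l + 3) * n) \<le> 2 * (3 * (l + 1) * (5 * r))"
    using r by (intro mult_le_mono) auto
  also have "\<dots> \<le> 120 * (l + 1) * r"
    by simp
  also have "\<dots> \<le> r * r"
    using r by (intro mult_le_mono) auto
  also have "\<dots> \<le> Suc r * r"
    by simp
  finally show ?thesis
    unfolding r(3) choose_two by simp
qed

lemma card_edges_touching_le:
  assumes "finite V" "D \<subseteq> V" "B \<subseteq> complete_graph_edges V"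
  shows "card {e \<in> B. e \<inter> D \<noteq> {}} \<le> card D * card V"
proof -
  have "{e \<in> B. e \<inter> D \<noteq> {}} \<subseteq> (\<lambda>(d, z). {d, z}) ` (D \<times> V)"
  proof
    fix e assume "e \<in> {e \<in> B. e \<inter> D \<noteq> {}}"
    then obtain d where d: "e \<in> nsets V 2" "d \<in> e" "d \<in> D"
      using assms(3) by (auto simp: complete_graph_edges_def)
    then obtain z where "e = {d, z}" "z \<in> V"
      by (elim nsets2_E) (auto simp: insert_commute)
    with d show "e \<in> (\<lambda>(d, z). {d, z}) ` (D \<times> V)" by force
  qed
  then have "card {e \<in> B. e \<inter> D \<noteq> {}} \<le> card (D \<times> V)"
    using assms finite_subset[OF assms(2,1)] by (intro surj_card_le) auto
  then show ?thesis by (simp add: card_cartesian_product)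
qed

section \<open>Bounding \<open>n\<close> in terms of \<open>l\<close>\<close>

lemma nontrivial_graphical_design_bound:
  assumes "nontrivial_graphical_design n t k l \<B>" "2 \<le> t"
  shows "n < 500 * (l + 1)"
proof (rule ccontr)
  assume "\<not> n < 500 * (l + 1)"
  then have n: "500 * (l + 1) \<le> n" by simp
  define V where "V = {..<n}"
  define X where "X = complete_graph_edges V"
  have D: "t_design X t (n choose 2) k l \<B>" and N: "nontrivial_design X t k \<B>"
    and G: "graphical V k \<B>"
    using assms(1) by (auto simp: nontrivial_graphical_design_def X_def V_def)
  have X: "X = nsets V 2" "finite X" "card X = n choose 2" "finite V"
    by (auto simp: X_def V_def complete_graph_edges_def finite_imp_finite_nsets)
  have tk: "t < k" "k < card X"
    using N by (auto simp: nontrivial_design_def)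
  have blocks: "set_mset \<B> \<subseteq> nsets X k"
    using D by (auto simp: t_design_def)
  have tk': "t + k < n choose 2"
    using nontrivial_design_bound[OF D N] .
  define q where "q = n div 4"
  have q: "2 * l + 10 \<le> q" "4 * q \<le> n"
    using n by (auto simp: q_def)
  define a where "a = n - q"
  have a: "a + q = n" using q by (auto simp: a_def)
  \<comment> \<open>Layout of \<open>T\<close>: \<open>t - 2\<close> edges below \<open>a\<close>,
    two isolated edges \<open>e1\<close> and \<open>e2\<close> on the four vertices from
    \<open>a\<close> on, and nothing on the remaining \<open>q - 4\<close> vertices
    \<open>U0\<close>.\<close>
  define U0 where "U0 = {a + 4..<n}"
  have U0: "U0 \<subseteq> V" "finite U0" "card U0 = q - 4"
    using a by (auto simp: U0_def V_def)
  define e1 e2 where "e1 = {a, a + 1}" and "e2 = {a + 2, a + 3}"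
  have "t \<le> a choose 2"
    using tk' tk(1) choose_two_ge_half[of n] n by (simp add: a_def q_def)
  then have "t - 2 \<le> card (nsets {..<a} 2)" by simp
  then obtain T0 where T0: "T0 \<subseteq> nsets {..<a} 2" "card T0 = t - 2" "finite T0"
    by (rule obtain_subset_with_card_n)
  define T where "T = insert e1 (insert e2 T0)"
  have T0': "x < a" if "e \<in> T0" "x \<in> e" for x e
    using that T0 by (auto simp: nsets_def)
  have e_notin: "e1 \<notin> T0" "e2 \<notin> T0" "e1 \<noteq> e2"
    using T0'[of e1 a] T0'[of e2 "a + 2"] by (auto simp: e1_def e2_def doubleton_eq_iff)
  have e: "e1 \<in> T" "e2 \<in> T"
    by (auto simp: T_def)
  have T: "finite T" "card T = t" "T \<subseteq> X"
  proof -
    show "finite T" "card T = t"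
      using T0 e_notin assms(2) by (auto simp: T_def)
    have "nsets {..<a} 2 \<subseteq> nsets V 2"
      using a by (intro nsets_mono) (auto simp: V_def)
    moreover have "e1 \<in> nsets V 2" "e2 \<in> nsets V 2"
      using a q by (auto simp: e1_def e2_def V_def)
    ultimately show "T \<subseteq> X"
      using T0 by (auto simp: T_def X)
  qed
  have TU0: "x \<notin> U0" if "f \<in> T" "x \<in> f" for f x
    using that T0' by (fastforce simp: T_def e1_def e2_def U0_def)
  have own_end: "x \<notin> f" if "f \<in> T - {e'}" "x \<in> e'" "e' = e1 \<or> e' = e2" for f x e'
    using that T0'[of f x] by (auto simp: T_def e1_def e2_def)
  obtain B where B: "B \<in># \<B>" "T \<subseteq> B"
    using design_block_exists[OF D T(3,2)] .
  have BX: "B \<subseteq> X" "card B = k" "finite B"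
    using B blocks by (auto simp: nsets_def)
  have tw: "twins B u w"
    if "T' \<subseteq> B" "card T' = t" "U \<subseteq> V" "\<And>f. f \<in> T' \<Longrightarrow> f \<inter> U = {}" "2 * l < card U" "u \<in> U" "w \<in> U"
    for T' U u w
  proof (rule twins_uncovered[OF D[unfolded X_def] G B(1) that(1-3)])
    show "finite U" using that X finite_subset by blast
    show "U \<inter> \<Union>T' = {}" using that by blast
  qed (use that in auto)
  have swap: "insert f (T - {e'}) \<subseteq> B" "card (insert f (T - {e'})) = t"
    if "f \<in> B - T" "e' \<in> T" for f e'
    using that B T by (auto simp: card_Diff_singleton) (metis Suc_pred assms(2) card_gt_0_iff empty_iff)+
  have edge: "\<exists>x y. e' = {x, y} \<and> x \<noteq> y \<and> x \<in> V \<and> y \<in> V" if "e' \<in> B" for e'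
  proof -
    have "e' \<in> nsets V 2" using that BX X by blast
    then show ?thesis by (elim nsets2_E) blast
  qed

  \<comment> \<open>Otherwise, exchange \<open>e1\<close> for some \<open>f\<close> in
    \<open>B - T\<close>. As \<open>f\<close> differs from \<open>e1\<close>, an end
    \<open>x\<close> of \<open>e1\<close> is off \<open>f\<close> and becomes a twin of the vertices
    of \<open>U0\<close>. The edge \<open>e1 = {x, y}\<close> of \<open>B\<close> then yields
    \<open>{u, y}\<close> in \<open>B\<close>, which meets \<open>U0\<close> and so is not in
    \<open>T\<close>.\<close>
  have touch: "\<exists>f \<in> B - T. f \<inter> U0 \<noteq> {}"
  proof (rule ccontr)
    assume none: "\<not> ?thesis"
    have "\<not> B \<subseteq> T"
      using BX T tk card_mono[of T B] by auto
    then obtain f where f: "f \<in> B - T" by blast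
    obtain p p' where pp: "f = {p, p'}" "p \<noteq> p'"
      using edge f by blast
    then have "a \<notin> f \<or> a + 1 \<notin> f"
      using f e(1) by (auto simp: e1_def insert_commute)
    moreover have "e1 = {a, a + 1}" "e1 = {a + 1, a}" "a \<noteq> a + 1"
      by (auto simp: e1_def)
    ultimately obtain x y where xy: "e1 = {x, y}" "x \<noteq> y" "x \<notin> f"
      by metis
    have xV: "x \<in> V" "y \<notin> U0"
      using xy e T X TU0 by (auto simp: nsets_def)
    obtain u where u: "u \<in> U0"
      using U0 q by fastforce
    have "twins B x u"
    proof (rule tw[OF swap[OF f e(1)]])
      show "insert x U0 \<subseteq> V" using xV U0 by blast
      show "g \<inter> insert x U0 = {}" if "g \<in> insert f (T - {e1})" for g
      proof (cases "g = f")
        case True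
        then show ?thesis using xy f none by blast
      next
        case False
        then have "x \<notin> g" using that own_end[of g e1 x] xy by blast
        then show ?thesis using that False TU0 by blast
      qed
      show "2 * l < card (insert x U0)"
        using U0 q card_insert_le[of U0 x] by simp
    qed (use u in auto)
    moreover have "{x, y} \<in> B" "y \<noteq> u"
      using xy e B xV u by auto
    ultimately have "{u, y} \<in> B"
      using xy(2) by (metis twins_def)
    then show False
      using none TU0 u by blast
  qed
  have "\<exists>u\<in>U0. \<exists>w\<in>U0. u \<noteq> w \<and> {u, w} \<in> B"
  proof -
    obtain f u where f: "f \<in> B - T" "u \<in> f" "u \<in> U0" using touch by blast
    then obtain s where s: "f = {u, s}" "s \<noteq> u"
      using edge[of f] by blast
    show ?thesis
    proof (cases "s \<in> U0")
      case True
      then show ?thesis using f s by (metis DiffD1)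
    next
      case False
      \<comment> \<open>Two isolated edges are kept so that one of them avoids \<open>s\<close>.
        Exchanging it for \<open>f\<close> uncovers both its ends, which join
        \<open>U0 - {u}\<close> in one set of pairwise twins; as that edge lies in \<open>B\<close>,
        the set is a clique.\<close>
      have "s \<notin> e1 \<or> s \<notin> e2"
        by (auto simp: e1_def e2_def)
      then obtain e' where e': "e' = e1 \<or> e' = e2" "s \<notin> e'"
        by metis
      then have e'T: "e' \<in> T" using e by blast
      then obtain x y where xy: "e' = {x, y}" "x \<noteq> y" "x \<in> V" "y \<in> V"
        using edge B by blast
      define U where "U = insert x (insert y (U0 - {u}))"
      have twU: "twins B c d" if "c \<in> U" "d \<in> U" for c d
      proof (rule tw[OF swap[OF f(1) e'T] _ _ _ that])
        show "U \<subseteq> V" using xy U0 by (auto simp: U_def)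
        show "g \<inter> U = {}" if "g \<in> insert f (T - {e'})" for g
        proof (cases "g = f")
          case True
          then show ?thesis
            using s xy e' False f TU0[OF e'T] by (auto simp: U_def)
        next
          case gf: False
          then have "x \<notin> g" "y \<notin> g"
            using that own_end[of g e'] e' xy by auto
          then show ?thesis using that gf TU0 by (auto simp: U_def)
        qed
        have "card (U0 - {u}) \<le> card U"
          using U0 by (intro card_mono) (auto simp: U_def)
        then show "2 * l < card U"
          using U0 q f by simp
      qed
      have "\<not> card (U0 - {u}) \<le> Suc 0" using U0 q f by simp
      then obtain c d where cd: "c \<in> U0 - {u}" "d \<in> U0 - {u}" "c \<noteq> d"
        using U0(2) by (metis card_le_Suc0_iff_eq finite_Diff)
      then have "{c, d} \<in> B"
        using twins_homogeneous[of U B x y c d] twU xy e'T B by (auto simp: U_def)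
      then show ?thesis using cd by (metis DiffD1)
    qed
  qed
  then obtain u w where uw: "u \<in> U0" "w \<in> U0" "u \<noteq> w" "{u, w} \<in> B" by blast
  have "twins B c d" if "c \<in> U0" "d \<in> U0" for c d
  proof (rule tw[OF B(2) T(2) U0(1) _ _ that])
    show "f \<inter> U0 = {}" if "f \<in> T" for f
      using that TU0 by blast
    show "2 * l < card U0"
      using U0 q by simp
  qed
  then have U0B: "{c, d} \<in> B" if "c \<in> U0" "d \<in> U0" "c \<noteq> d" for c d
    using twins_homogeneous[of U0 B u w c d] uw that by metis
  have "nsets U0 2 \<subseteq> B - T"
    using U0B TU0 by (fastforce elim!: nsets2_E)
  then have "card (nsets U0 2) \<le> card (B - T)"
    using BX by (intro card_mono) auto
  also have "\<dots> = k - t"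
    using B T BX by (simp add: card_Diff_subset)
  finally have kt: "(2 * l + 3) * n \<le> k - t"
    using mult_le_choose_two[OF n] U0 by (simp add: q_def)
  have twV: "twins B c d" if "c \<in> V" "d \<in> V" for c d
  proof -
    \<comment> \<open>The first \<open>2 * l + 1\<close> vertices only pad \<open>c\<close> and
      \<open>d\<close> to a set of more than \<open>2 * l\<close> vertices. It stays small enough
      that at most \<open>k - t\<close> edges of \<open>B\<close> meet it, leaving \<open>t\<close>
      edges that miss it.\<close>
    define D where "D = insert c (insert d {..<2 * l + 1})"
    have DV: "D \<subseteq> V" using that n by (auto simp: D_def V_def)
    have "card D \<le> Suc (Suc (card {..<2 * l + 1}))"
      unfolding D_def by (intro card_insert_le_m1[THEN le_trans] le_refl) (auto simp: card_insert_if)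
    then have cD: "card D \<le> 2 * l + 3" by simp
    have "card {..<2 * l + 1} \<le> card D"
      by (intro card_mono) (auto simp: D_def)
    then have cD': "2 * l < card D" by simp
    have "card {e \<in> B. e \<inter> D \<noteq> {}} \<le> card D * card V"
      using card_edges_touching_le[OF X(4) DV] BX by (simp add: X_def)
    also have "\<dots> \<le> (2 * l + 3) * n"
      using cD by (simp add: V_def)
    finally have "card {e \<in> B. e \<inter> D \<noteq> {}} \<le> k - t"
      using kt by simp
    then have "t \<le> card (B - {e \<in> B. e \<inter> D \<noteq> {}})"
      using BX tk by (subst card_Diff_subset) auto
    then obtain T' where T': "T' \<subseteq> B - {e \<in> B. e \<inter> D \<noteq> {}}" "card T' = t"
      by (rule obtain_subset_with_card_n)
    show ?thesis
      by (rule tw[of T' D]) (use T' DV cD' in \<open>auto simp: D_def\<close>)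
  qed
  have "X \<subseteq> B"
  proof
    fix f assume "f \<in> X"
    then obtain c d where cd: "f = {c, d}" "c \<in> V" "d \<in> V" "c \<noteq> d"
      using X by (auto elim!: nsets2_E)
    obtain x y where "e1 = {x, y}" "x \<noteq> y" "x \<in> V" "y \<in> V"
      using edge e B by blast
    then show "f \<in> B"
      using twins_homogeneous[of V B x y c d] twV cd e B by auto
  qed
  then show False
    using BX tk card_mono[of B X] by auto
qed

section \<open>Finiteness for fixed \<open>l\<close>\<close>

theorem theorem1p1:
  fixes l :: nat
  assumes "0 < l"
  shows "finite {(n :: nat, t :: nat, k :: nat, \<B> :: nat set set multiset).
           0 < n \<and> 2 \<le> t \<and> 0 < k \<and> nontrivial_graphical_design n t k l \<B>}"
proof -
  define m where "m = 500 * (l + 1)"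
  define E where "E = complete_graph_edges {..<m}"
  \<comment> \<open>With \<open>n < m\<close>, all blocks live on the edges of one fixed complete
    graph, which bounds \<open>t\<close> and \<open>k\<close> as well; multiplicities are at most
    \<open>l\<close>.\<close>
  define M where "M = {\<B>. set_mset \<B> \<subseteq> Pow E \<and> (\<forall>B. count \<B> B \<le> l)}"
  have finE: "finite E"
    by (simp add: E_def complete_graph_edges_def finite_imp_finite_nsets)
  have "(n, t, k, \<B>) \<in> {..<m} \<times> {..card E} \<times> {..card E} \<times> M"
    if t: "2 \<le> t" and G: "nontrivial_graphical_design n t k l \<B>" for n t k \<B>
  proof -
    let ?X = "complete_graph_edges {..<n}"
    have n: "n < m"
      using nontrivial_graphical_design_bound[OF G t] by (simp add: m_def)
    then have XE: "?X \<subseteq> E"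
      unfolding E_def complete_graph_edges_def by (intro nsets_mono) auto
    have D: "t_design ?X t (n choose 2) k l \<B>" and N: "nontrivial_design ?X t k \<B>"
      using G by (auto simp: nontrivial_graphical_design_def)
    have "t < k" "k < card ?X"
      using N by (auto simp: nontrivial_design_def)
    moreover have "card ?X \<le> card E"
      using XE finE by (rule card_mono[rotated])
    moreover have "set_mset \<B> \<subseteq> Pow E"
      using D XE by (auto simp: t_design_def nsets_def)
    ultimately show ?thesis
      using n design_count_le[OF D] by (auto simp: M_def)
  qed
  moreover have "finite M"
    unfolding M_def using finE by (intro finite_bounded_multisets) simp
  then have "finite ({..<m} \<times> {..card E} \<times> {..card E} \<times> M)"
    by simp
  ultimately show ?thesis
    by (elim finite_subset[rotated]) blast
qed

end
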